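(* Let $n\ge1$, let $u_0,u,v,w\in\mathbb{R}$ and let $f(x,y,z)=u_0+ux+vy+wz$ on the unit sphere $S^2\subset\mathbb{R}^3$. There exists a unique Hermitian matrix $\mathbf{Q}(f)\in\mathrm{Herm}(\mathbb{C}^{n+1})$ such that $$u_0+u\cos\alpha+v\sin\alpha\cos\beta+w\sin\alpha\sin\beta=\big\langle\Psi(\alpha,\beta),\,\mathbf{Q}(f)\cdot\Psi(\alpha,\beta)\big\rangle$$ for all $\alpha\in[0,\pi]$ and all $\beta\in[0,2\pi]$. With rows and columns indexed by $0,\dots,n$, it is explicitly given by $$\mathbf{Q}(f)_{kk}=u_0-u\cdot\frac2n\Big(\frac n2-k\Big),\qquad \mathbf{Q}(f)_{l,l+1}=\frac1n\sqrt{(n-l)(1+l)}\,(v-iw),\qquad \mathbf{Q}(f)_{ab}=0,$$ where $k=0,\dots,n$, $l=0,\dots,n-1$, $a=0,\dots,n-2$ and $a+2\le b\le n$ (the remaining entries being determined by Hermitian symmetry).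
   Context: $\langle\cdot,\cdot\rangle$ is the Hermitian product on $\mathbb{C}^{n+1}$, linear in the second argument (antilinear in the first). For $\alpha\in[0,\pi]$, $\beta\in[0,2\pi]$, $\Psi(\alpha,\beta)\in\mathbb{C}^{n+1}$ is the vector with components $\Psi(\alpha,\beta)_k=\binom nk^{1/2}(\cos(\alpha/2))^k(\sin(\alpha/2))^{n-k}e^{i\beta k}$, $k=0,\dots,n$ (with $0^0=1$). $\mathrm{Herm}(\mathbb{C}^{n+1})$ is the space of Hermitian $(n+1)\times(n+1)$ matrices. *)

theory Defs
  imports Complex_Main "Jordan_Normal_Form.Schur_Decomposition"
begin

definition Herm :: "nat \<Rightarrow> complex mat set" where
  "Herm m = {A \<in> carrier_mat m m. mat_adjoint A = A}"

text \<open>The product \<open>y \<bullet>c x\<close> conjugates its right operand, so the arguments are swapped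
  to obtain a product that is antilinear in the first argument and linear in the second.\<close>

definition hprod :: "complex vec \<Rightarrow> complex vec \<Rightarrow> complex" where
  "hprod x y = y \<bullet>c x"

definition Psi :: "nat \<Rightarrow> real \<Rightarrow> real \<Rightarrow> complex vec" where
  "Psi n \<alpha> \<beta> = vec (n + 1) (\<lambda>k.
     complex_of_real (sqrt (real (n choose k)) * cos (\<alpha> / 2) ^ k * sin (\<alpha> / 2) ^ (n - k))
     * exp (\<i> * complex_of_real (\<beta> * real k)))"

text \<open>The matrix \<open>\<^bold>Q(f)\<close>. The parameter \<open>f\<close> is only evaluated on the unit sphere, whose polar
  axis is the first coordinate axis. The description is meaningful only for
  those \<open>f\<close> for which exactly one such matrix exists.\<close>

definition Qmat :: "nat \<Rightarrow> (real \<times> real \<times> real \<Rightarrow> real) \<Rightarrow> complex mat" where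
  "Qmat n f = (THE Q. Q \<in> Herm (n + 1) \<and>
     (\<forall>\<alpha>\<in>{0..pi}. \<forall>\<beta>\<in>{0..2 * pi}.
        complex_of_real (f (cos \<alpha>, sin \<alpha> * cos \<beta>, sin \<alpha> * sin \<beta>))
          = hprod (Psi n \<alpha> \<beta>) (Q *\<^sub>v Psi n \<alpha> \<beta>)))"

end

theory Submission
  imports Defs "HOL-Analysis.Weierstrass_Theorems"
begin

text \<open>Write \<open>c = cos (\<alpha>/2)\<close> and \<open>s = sin (\<alpha>/2)\<close>. The expectation of a matrix \<open>Q\<close> in the state
  \<open>\<Psi>(\<alpha>,\<beta>)\<close> is the double sum
  \<open>\<Sum>k l. Q(k,l) \<surd>(n choose k) \<surd>(n choose l) c^(k+l) s^(2n-k-l) e^(i\<beta>(l-k))\<close>.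

  Uniqueness: for \<open>s > 0\<close> put \<open>t = c/s\<close> and \<open>x = e^(i\<beta>)\<close>. Multiplied by \<open>x^n / s^(2n)\<close>, the double
  sum becomes a polynomial in \<open>t\<close> and \<open>x\<close> whose monomials have the exponents \<open>(k+l, n+l-k)\<close>. Distinct
  index pairs \<open>(k,l)\<close> give distinct exponents, and \<open>t\<close> and \<open>x\<close> range independently over infinite
  sets, so the expectations determine every entry of \<open>Q\<close>
  (\<open>bivariate_coeffs_zero\<close>, \<open>expectation_determines_matrix\<close>).

  Existence: the expectation of the tridiagonal matrix in the theorem is computed directly. With
  \<open>c\<^sup>2 + s\<^sup>2 = 1\<close> the weights \<open>(n choose k) c^(2k) s^(2(n-k))\<close> form a binomial distribution with mean
  \<open>n c\<^sup>2\<close>, so the diagonal contributes \<open>u\<^sub>0 - u + 2 u c\<^sup>2 = u\<^sub>0 + u cos \<alpha>\<close>. The square roots on the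
  off-diagonal are chosen so that, by binomial absorption, the weights there form \<open>c s\<close> times
  the binomial distribution for \<open>n - 1\<close>. The total weight is therefore \<open>c s\<close>, and the upper diagonal
  together with its conjugate contributes
  \<open>2 c s Re (e^(i\<beta>) (v - i w)) = sin \<alpha> (v cos \<beta> + w sin \<beta>)\<close>.\<close>

section \<open>Expectations in the states \<open>\<Psi>\<close>\<close>

definition Psi_amp :: "nat \<Rightarrow> real \<Rightarrow> nat \<Rightarrow> real" where
  "Psi_amp n \<alpha> k = sqrt (real (n choose k)) * cos (\<alpha> / 2) ^ k * sin (\<alpha> / 2) ^ (n - k)"

lemma Psi_index:
  assumes "k \<le> n"
  shows "Psi n \<alpha> \<beta> $ k = complex_of_real (Psi_amp n \<alpha> k) * cis (\<beta> * real k)"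
  using assms by (simp add: Psi_def Psi_amp_def cis_conv_exp)

lemma expectation_expand:
  assumes Q: "Q \<in> carrier_mat (n + 1) (n + 1)"
  shows "hprod (Psi n \<alpha> \<beta>) (Q *\<^sub>v Psi n \<alpha> \<beta>) =
    (\<Sum>k\<le>n. \<Sum>l\<le>n. Q $$ (k, l) * complex_of_real (Psi_amp n \<alpha> k * Psi_amp n \<alpha> l)
       * cis (\<beta> * (real l - real k)))"
proof -
  have dimP: "dim_vec (Psi n \<alpha> \<beta>) = Suc n" by (simp add: Psi_def)
  have range: "{0..<Suc n} = {..n}" by auto
  have dimQ: "dim_row Q = Suc n" "dim_col Q = Suc n" using Q by auto
  have "hprod (Psi n \<alpha> \<beta>) (Q *\<^sub>v Psi n \<alpha> \<beta>) =
     (\<Sum>k\<le>n. (\<Sum>l\<le>n. Q $$ (k, l) * Psi n \<alpha> \<beta> $ l) * cnj (Psi n \<alpha> \<beta> $ k))"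
    unfolding hprod_def scalar_prod_def
    using dimQ dimP by (auto simp: range scalar_prod_def intro!: sum.cong)
  also have "\<dots> = (\<Sum>k\<le>n. \<Sum>l\<le>n. Q $$ (k, l) * complex_of_real (Psi_amp n \<alpha> k * Psi_amp n \<alpha> l)
       * cis (\<beta> * (real l - real k)))"
  proof (intro sum.cong refl, unfold sum_distrib_right, intro sum.cong refl)
    fix k l assume "k \<in> {..n}" "l \<in> {..n}"
    moreover have "cis (\<beta> * real l) * cis (- (\<beta> * real k)) = cis (\<beta> * (real l - real k))"
      by (simp add: cis_mult algebra_simps)
    ultimately show "Q $$ (k, l) * Psi n \<alpha> \<beta> $ l * cnj (Psi n \<alpha> \<beta> $ k) =
        Q $$ (k, l) * complex_of_real (Psi_amp n \<alpha> k * Psi_amp n \<alpha> l)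
          * cis (\<beta> * (real l - real k))"
      by (simp add: Psi_index cis_cnj mult_ac)
  qed
  finally show ?thesis .
qed

section \<open>Uniqueness\<close>

text \<open>A nonzero polynomial in one variable has finitely many roots. This is used first for \<open>x\<close> with
  \<open>t\<close> fixed, and then for the coefficient of \<open>x ^ q r\<close>, a polynomial in \<open>t\<close>. The two-variable polynomial is given as a sum over arbitrary indices with pairwise distinct
  exponents, so that no reindexing is needed when the lemma is used.\<close>

lemma bivariate_coeffs_zero:
  fixes b :: "'s \<Rightarrow> 'a :: idom"
  assumes S: "finite S" and inj: "inj_on (\<lambda>s. (p s, q s)) S"
    and T: "infinite T" and X: "infinite X"
    and zero: "\<And>t x. t \<in> T \<Longrightarrow> x \<in> X \<Longrightarrow> (\<Sum>s\<in>S. b s * t ^ p s * x ^ q s) = 0"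
    and r: "r \<in> S"
  shows "b r = 0"
proof -
  have poly_zero: "P = 0" if "infinite Y" "\<And>y. y \<in> Y \<Longrightarrow> poly P y = 0" for P :: "'a poly" and Y
    using that poly_roots_finite[of P] finite_subset[of Y "{y. poly P y = 0}"] by blast
  have slice: "(\<Sum>s\<in>S. if q s = q r then b s * t ^ p s else 0) = 0" if "t \<in> T" for t
  proof -
    have "(\<Sum>s\<in>S. monom (b s * t ^ p s) (q s)) = 0"
      by (rule poly_zero[OF X]) (simp add: poly_sum poly_monom zero that)
    from arg_cong[OF this, of "\<lambda>P. coeff P (q r)"] show ?thesis
      by (simp add: coeff_sum)
  qed
  have "(\<Sum>s\<in>S. monom (if q s = q r then b s else 0) (p s)) = 0"
  proof (rule poly_zero[OF T])
    fix t assume "t \<in> T"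
    have "poly (\<Sum>s\<in>S. monom (if q s = q r then b s else 0) (p s)) t
      = (\<Sum>s\<in>S. if q s = q r then b s * t ^ p s else 0)"
      by (simp add: poly_sum poly_monom if_distrib[of "\<lambda>z. z * _"] cong: if_cong)
    then show "poly (\<Sum>s\<in>S. monom (if q s = q r then b s else 0) (p s)) t = 0"
      using slice[OF \<open>t \<in> T\<close>] by simp
  qed
  from arg_cong[OF this, of "\<lambda>P. coeff P (p r)"]
  have "(\<Sum>s\<in>S. if p s = p r then (if q s = q r then b s else 0) else 0) = 0"
    by (simp add: coeff_sum)
  also have "(\<Sum>s\<in>S. if p s = p r then (if q s = q r then b s else 0) else 0)
    = (\<Sum>s\<in>S. if s = r then b s else 0)"
    using inj r by (intro sum.cong) (auto dest: inj_onD)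
  finally show ?thesis using S r by simp
qed

text \<open>The phase \<open>\<beta>\<close> separates the diagonals \<open>l - k = const\<close>
  from each other and \<open>\<alpha>\<close>, through \<open>t = cot (\<alpha>/2)\<close>, separates the entries within one diagonal.\<close>

lemma expectation_determines_matrix:
  assumes A: "A \<in> carrier_mat (n + 1) (n + 1)" and B: "B \<in> carrier_mat (n + 1) (n + 1)"
    and eq: "\<And>\<alpha> \<beta>. \<alpha> \<in> {0..pi} \<Longrightarrow> \<beta> \<in> {0..2 * pi} \<Longrightarrow>
      hprod (Psi n \<alpha> \<beta>) (A *\<^sub>v Psi n \<alpha> \<beta>) = hprod (Psi n \<alpha> \<beta>) (B *\<^sub>v Psi n \<alpha> \<beta>)"
  shows "A = B"
proof -
  define S where "S = {..n} \<times> {..n}"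
  define p where "p = (\<lambda>(k::nat, l::nat). k + l)"
  define q where "q = (\<lambda>(k::nat, l::nat). n + l - k)"
  define b where "b = (\<lambda>(k, l). (A $$ (k, l) - B $$ (k, l))
    * complex_of_real (sqrt (real (n choose k)) * sqrt (real (n choose l))))"
  define T where "T = complex_of_real ` {0<..}"
  define X where "X = cis ` {0..pi}"
  have "infinite T"
    unfolding T_def by (subst finite_image_iff) (auto simp: inj_on_def infinite_Ioi)
  have "inj_on cis {0..pi}"
    by (rule inj_onI) (metis atLeastAtMost_iff cis.sel(1) cos_inj_pi)
  then have "infinite X"
    unfolding X_def by (subst finite_image_iff) (auto simp: infinite_Icc_iff)
  have inj: "inj_on (\<lambda>s. (p s, q s)) S"
    by (auto simp: inj_on_def S_def p_def q_def)
  have vanish: "(\<Sum>s\<in>S. b s * t ^ p s * x ^ q s) = 0" if "t \<in> T" "x \<in> X" for t x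
  proof -
    from that obtain \<tau> \<beta> where \<tau>: "\<tau> > 0" "t = complex_of_real \<tau>"
      and \<beta>: "0 \<le> \<beta>" "\<beta> \<le> pi" "x = cis \<beta>"
      by (auto simp: T_def X_def)
    \<comment> \<open>the angle with \<open>cot (\<alpha>/2) = \<tau>\<close>\<close>
    define \<alpha> where "\<alpha> = 2 * arctan (1 / \<tau>)"
    have arctan: "0 < arctan (1 / \<tau>)" "arctan (1 / \<tau>) < pi / 2"
      using \<tau> arctan_ubound[of "1 / \<tau>"] by auto
    then have \<alpha>: "\<alpha> \<in> {0..pi}" by (auto simp: \<alpha>_def)
    define s where "s = sin (\<alpha> / 2)"
    have s: "s \<noteq> 0"
      using sin_gt_zero[of "arctan (1 / \<tau>)"] arctan by (simp add: s_def \<alpha>_def)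
    have c: "cos (\<alpha> / 2) = \<tau> * s"
      using \<tau> by (simp add: s_def \<alpha>_def sin_arctan cos_arctan)
    have amp: "Psi_amp n \<alpha> k = sqrt (real (n choose k)) * \<tau> ^ k * s ^ n" if "k \<le> n" for k
    proof -
      have "s ^ k * s ^ (n - k) = s ^ n" using that by (simp flip: power_add)
      then show ?thesis
        by (simp only: Psi_amp_def c s_def[symmetric] power_mult_distrib mult.assoc)
    qed
    \<comment> \<open>The factor \<open>x ^ n\<close> makes the exponents of \<open>x\<close> nonnegative.\<close>
    have term_eq: "(A $$ (k, l) - B $$ (k, l)) * complex_of_real (Psi_amp n \<alpha> k * Psi_amp n \<alpha> l)
        * cis (\<beta> * (real l - real k)) * x ^ n
      = complex_of_real (s ^ n * s ^ n) * (b (k, l) * t ^ p (k, l) * x ^ q (k, l))"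
      if "k \<le> n" "l \<le> n" for k l
    proof -
      have "x ^ q (k, l) = cis (\<beta> * (real l - real k)) * x ^ n"
        using that unfolding \<beta> q_def DeMoivre cis_mult by (simp add: of_nat_diff algebra_simps)
      then show ?thesis
        using that by (simp add: amp b_def p_def \<tau> power_add mult_ac)
    qed
    have "0 = (hprod (Psi n \<alpha> \<beta>) (A *\<^sub>v Psi n \<alpha> \<beta>) - hprod (Psi n \<alpha> \<beta>) (B *\<^sub>v Psi n \<alpha> \<beta>)) * x ^ n"
      using eq[of \<alpha> \<beta>] \<alpha> \<beta> by simp
    also have "\<dots> = (\<Sum>k\<le>n. \<Sum>l\<le>n. (A $$ (k, l) - B $$ (k, l))
        * complex_of_real (Psi_amp n \<alpha> k * Psi_amp n \<alpha> l)
        * cis (\<beta> * (real l - real k)) * x ^ n)"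
      unfolding expectation_expand[OF A] expectation_expand[OF B]
        sum_subtractf[symmetric] sum_distrib_right left_diff_distrib ..
    also have "\<dots> = complex_of_real (s ^ n * s ^ n) * (\<Sum>s\<in>S. b s * t ^ p s * x ^ q s)"
      unfolding S_def sum.cartesian_product' sum_distrib_left
      by (intro sum.cong refl) (auto simp: term_eq simp del: of_real_mult)
    finally show ?thesis using s by simp
  qed
  have entry: "A $$ (k, l) = B $$ (k, l)" if "k \<le> n" "l \<le> n" for k l
  proof -
    have "b (k, l) = 0"
      by (rule bivariate_coeffs_zero[OF _ inj \<open>infinite T\<close> \<open>infinite X\<close> vanish])
        (use that in \<open>auto simp: S_def\<close>)
    moreover have "n choose k \<noteq> 0" "n choose l \<noteq> 0" using that by auto
    ultimately show ?thesis by (simp add: b_def)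
  qed
  show ?thesis
    by (rule eq_matI) (use A B in \<open>auto intro!: entry\<close>)
qed

section \<open>The tridiagonal matrix\<close>

definition linear_symbol_mat :: "nat \<Rightarrow> real \<Rightarrow> real \<Rightarrow> complex \<Rightarrow> complex mat" where
  "linear_symbol_mat n u\<^sub>0 u z = Matrix.mat (n + 1) (n + 1) (\<lambda>(k, l).
     if l = k then complex_of_real (u\<^sub>0 - u * (2 / real n) * (real n / 2 - real k))
     else if l = k + 1 then
       complex_of_real (1 / real n * sqrt ((real n - real k) * (1 + real k))) * z
     else if k = l + 1 then
       complex_of_real (1 / real n * sqrt ((real n - real l) * (1 + real l))) * cnj z
     else 0)"

lemma linear_symbol_mat_Herm: "linear_symbol_mat n u\<^sub>0 u z \<in> Herm (n + 1)"
proof -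
  let ?Q = "linear_symbol_mat n u\<^sub>0 u z"
  have "mat_adjoint ?Q = ?Q"
    by (rule eq_matI) (auto simp: mat_adjoint_def linear_symbol_mat_def mat_of_rows_index)
  then show ?thesis by (simp add: Herm_def linear_symbol_mat_def)
qed

lemma sum_tridiagonal:
  fixes a b c :: "nat \<Rightarrow> 'a :: comm_monoid_add"
  shows "(\<Sum>k\<le>n. \<Sum>l\<le>n. if l = k then a k else if l = k + 1 then b k
      else if k = l + 1 then c l else 0)
    = (\<Sum>k\<le>n. a k) + (\<Sum>l<n. b l) + (\<Sum>l<n. c l)" (is "?L = _")
proof -
  have shift: "(\<Sum>k\<le>n. \<Sum>l\<le>n. if l = k + 1 then d k else 0) = (\<Sum>l<n. d l)"
    for d :: "nat \<Rightarrow> 'a"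
  proof -
    have "(\<Sum>k\<le>n. \<Sum>l\<le>n. if l = k + 1 then d k else 0) = (\<Sum>k\<le>n. if k < n then d k else 0)"
      by (intro sum.cong) auto
    also have "\<dots> = (\<Sum>k<n. d k)"
      by (rule sum.mono_neutral_cong_right) auto
    finally show ?thesis .
  qed
  have "?L = (\<Sum>k\<le>n. \<Sum>l\<le>n. (if l = k then a k else 0)
      + (if l = k + 1 then b k else 0) + (if k = l + 1 then c l else 0))"
    by (intro sum.cong) auto
  also have "\<dots> = (\<Sum>k\<le>n. \<Sum>l\<le>n. if l = k then a k else 0)
      + (\<Sum>k\<le>n. \<Sum>l\<le>n. if l = k + 1 then b k else 0)
      + (\<Sum>l\<le>n. \<Sum>k\<le>n. if k = l + 1 then c l else 0)"
    by (simp only: sum.distrib sum.swap[of "\<lambda>k l. if k = l + 1 then c l else 0"])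
  also have "(\<Sum>k\<le>n. \<Sum>l\<le>n. if l = k then a k else 0) = (\<Sum>k\<le>n. a k)"
    by (intro sum.cong) auto
  finally show ?thesis by (simp only: shift)
qed

lemma Psi_amp_square:
  assumes "k \<le> n"
  shows "Psi_amp n \<alpha> k * Psi_amp n \<alpha> k = Bernstein n k ((cos (\<alpha> / 2))\<^sup>2)"
proof -
  have s: "1 - (cos (\<alpha> / 2))\<^sup>2 = (sin (\<alpha> / 2))\<^sup>2" by (simp add: sin_squared_eq)
  have "Psi_amp n \<alpha> k * Psi_amp n \<alpha> k = (sqrt (real (n choose k)) * sqrt (real (n choose k)))
    * (cos (\<alpha> / 2) ^ k)\<^sup>2 * (sin (\<alpha> / 2) ^ (n - k))\<^sup>2"
    by (simp only: Psi_amp_def power2_eq_square mult_ac)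
  then show ?thesis
    by (simp add: Bernstein_def s power_mult[symmetric] mult.commute)
qed

text \<open>Both \<open>(n - l) (n choose l)\<close> and \<open>(l + 1) (n choose (l + 1))\<close> equal \<open>n ((n - 1) choose l)\<close>.
  Hence the factor \<open>\<surd>((n - l) (1 + l)) / n\<close> turns the geometric mean of \<open>n choose l\<close> and
  \<open>n choose (l + 1)\<close> into \<open>(n - 1) choose l\<close>.\<close>

lemma sqrt_binomial_absorb:
  assumes "l < n"
  shows "1 / real n * sqrt ((real n - real l) * (1 + real l))
    * (sqrt (real (n choose l)) * sqrt (real (n choose (l + 1)))) = real ((n - 1) choose l)"
proof -
  have "(n - l) * (n choose l) = n * ((n - 1) choose l)"
    by (rule binomial_absorb_comp)
  moreover have "(l + 1) * (n choose (l + 1)) = n * ((n - 1) choose l)"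
    using times_binomial_minus1_eq[of "l + 1" n] by simp
  ultimately have "real ((n - l) * (n choose l)) = real (n * ((n - 1) choose l))"
    "real ((l + 1) * (n choose (l + 1))) = real (n * ((n - 1) choose l))"
    by (simp_all only:)
  then have absorb: "(real n - real l) * real (n choose l) = real n * real ((n - 1) choose l)"
    "(1 + real l) * real (n choose (l + 1)) = real n * real ((n - 1) choose l)"
    using assms by (simp_all only: of_nat_mult of_nat_diff of_nat_add of_nat_1 add.commute less_imp_le)
  have "((real n - real l) * (1 + real l)) * (real (n choose l) * real (n choose (l + 1)))
     = ((real n - real l) * real (n choose l)) * ((1 + real l) * real (n choose (l + 1)))"
    by (simp only: mult_ac)
  also have "\<dots> = (real n * real ((n - 1) choose l))\<^sup>2"
    unfolding absorb power2_eq_square ..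
  finally have "sqrt ((real n - real l) * (1 + real l))
      * (sqrt (real (n choose l)) * sqrt (real (n choose (l + 1))))
     = real n * real ((n - 1) choose l)"
    by (simp only: real_sqrt_mult[symmetric] real_sqrt_abs) simp
  then show ?thesis using assms by simp
qed

lemma Psi_amp_neighbours:
  assumes "l < n"
  shows "1 / real n * sqrt ((real n - real l) * (1 + real l)) * (Psi_amp n \<alpha> l * Psi_amp n \<alpha> (l + 1))
    = sin \<alpha> / 2 * Bernstein (n - 1) l ((cos (\<alpha> / 2))\<^sup>2)"
proof -
  define c where "c = cos (\<alpha> / 2)"
  define s where "s = sin (\<alpha> / 2)"
  have s2: "1 - c\<^sup>2 = s\<^sup>2" by (simp add: c_def s_def sin_squared_eq)
  have sin: "sin \<alpha> / 2 = c * s"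
    using sin_double[of "\<alpha> / 2"] by (simp add: c_def s_def)
  have n: "n - l = Suc (n - 1 - l)" "n - (l + 1) = n - 1 - l" using assms by auto
  have "1 / real n * sqrt ((real n - real l) * (1 + real l)) * (Psi_amp n \<alpha> l * Psi_amp n \<alpha> (l + 1))
    = (1 / real n * sqrt ((real n - real l) * (1 + real l))
        * (sqrt (real (n choose l)) * sqrt (real (n choose (l + 1)))))
      * ((c ^ l * c ^ (l + 1)) * (s ^ (n - l) * s ^ (n - (l + 1))))"
    by (simp only: Psi_amp_def c_def s_def mult_ac)
  also have "\<dots> = real ((n - 1) choose l) * ((c ^ l * c ^ (l + 1)) * (s ^ (n - l) * s ^ (n - (l + 1))))"
    unfolding sqrt_binomial_absorb[OF assms] ..
  also have "\<dots> = c * s * (real ((n - 1) choose l) * (c\<^sup>2) ^ l * (s\<^sup>2) ^ (n - 1 - l))"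
    unfolding n by (simp add: power2_eq_square power_mult_distrib mult_ac)
  finally show ?thesis unfolding sin Bernstein_def c_def[symmetric] s2 .
qed

lemma expectation_linear_symbol_mat:
  assumes n: "n \<ge> 1"
  shows "hprod (Psi n \<alpha> \<beta>) (linear_symbol_mat n u\<^sub>0 u (Complex v (- w)) *\<^sub>v Psi n \<alpha> \<beta>)
    = complex_of_real (u\<^sub>0 + u * cos \<alpha> + v * sin \<alpha> * cos \<beta> + w * sin \<alpha> * sin \<beta>)"
proof -
  let ?z = "Complex v (- w)"
  let ?x = "(cos (\<alpha> / 2))\<^sup>2"
  let ?Q = "linear_symbol_mat n u\<^sub>0 u ?z"
  have Q: "?Q \<in> carrier_mat (n + 1) (n + 1)" by (simp add: linear_symbol_mat_def)
  define d where "d k = u\<^sub>0 - u * (2 / real n) * (real n / 2 - real k)" for k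
  define e where "e l = 1 / real n * sqrt ((real n - real l) * (1 + real l))" for l
  have e: "complex_of_real (e l) * complex_of_real (Psi_amp n \<alpha> l * Psi_amp n \<alpha> (l + 1))
      = complex_of_real (sin \<alpha> / 2 * Bernstein (n - 1) l ?x)" if "l < n" for l
    using Psi_amp_neighbours[OF that, of \<alpha>] unfolding e_def by (metis of_real_mult)
  have "(\<Sum>l<n. Bernstein (n - 1) l ?x) = 1"
    using n by (cases n) (simp_all add: lessThan_Suc_atMost)
  then have weight: "(\<Sum>l<n. complex_of_real (sin \<alpha> / 2 * Bernstein (n - 1) l ?x) * y)
      = complex_of_real (sin \<alpha> / 2) * y" for y
    by (simp only: sum_distrib_right[symmetric] of_real_sum[symmetric]
        sum_distrib_left[symmetric]) simp
  have entry: "?Q $$ (k, l) = (if l = k then complex_of_real (d k)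
      else if l = k + 1 then complex_of_real (e k) * ?z
      else if k = l + 1 then complex_of_real (e l) * cnj ?z else 0)" if "k \<le> n" "l \<le> n" for k l
    using that by (simp add: linear_symbol_mat_def d_def e_def)
  have "hprod (Psi n \<alpha> \<beta>) (?Q *\<^sub>v Psi n \<alpha> \<beta>)
    = (\<Sum>k\<le>n. \<Sum>l\<le>n. if l = k then complex_of_real (d k * Bernstein n k ?x)
        else if l = k + 1 then
          complex_of_real (sin \<alpha> / 2 * Bernstein (n - 1) k ?x) * (?z * cis \<beta>)
        else if k = l + 1 then
          complex_of_real (sin \<alpha> / 2 * Bernstein (n - 1) l ?x) * (cnj ?z * cis (- \<beta>))
        else 0)"
    unfolding expectation_expand[OF Q]
  proof (intro sum.cong refl)
    fix k l assume "k \<in> {..n}" "l \<in> {..n}"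
    then have k: "k \<le> n" and l: "l \<le> n" by auto
    consider "l = k" | "l = k + 1" | "k = l + 1" | "l \<noteq> k" "l \<noteq> k + 1" "k \<noteq> l + 1" by blast
    then show "?Q $$ (k, l) * complex_of_real (Psi_amp n \<alpha> k * Psi_amp n \<alpha> l)
        * cis (\<beta> * (real l - real k))
      = (if l = k then complex_of_real (d k * Bernstein n k ?x)
        else if l = k + 1 then
          complex_of_real (sin \<alpha> / 2 * Bernstein (n - 1) k ?x) * (?z * cis \<beta>)
        else if k = l + 1 then
          complex_of_real (sin \<alpha> / 2 * Bernstein (n - 1) l ?x) * (cnj ?z * cis (- \<beta>))
        else 0)"
    proof cases
      case 1
      then have "?Q $$ (k, l) * complex_of_real (Psi_amp n \<alpha> k * Psi_amp n \<alpha> l)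
          * cis (\<beta> * (real l - real k))
        = complex_of_real (d k * (Psi_amp n \<alpha> k * Psi_amp n \<alpha> k))"
        using k by (simp add: entry)
      with 1 show ?thesis unfolding Psi_amp_square[OF k] by simp
    next
      case 2
      then have "k < n" using l by simp
      have "?Q $$ (k, l) * complex_of_real (Psi_amp n \<alpha> k * Psi_amp n \<alpha> l)
          * cis (\<beta> * (real l - real k))
        = (complex_of_real (e k) * complex_of_real (Psi_amp n \<alpha> k * Psi_amp n \<alpha> (k + 1)))
          * (?z * cis \<beta>)"
        using 2 k l by (simp add: entry mult_ac)
      with 2 show ?thesis unfolding e[OF \<open>k < n\<close>] by simp
    next
      case 3
      then have "l < n" using k by simp
      have "?Q $$ (k, l) * complex_of_real (Psi_amp n \<alpha> k * Psi_amp n \<alpha> l)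
          * cis (\<beta> * (real l - real k))
        = (complex_of_real (e l) * complex_of_real (Psi_amp n \<alpha> l * Psi_amp n \<alpha> (l + 1)))
          * (cnj ?z * cis (- \<beta>))"
        using 3 k l by (simp add: entry mult_ac)
      with 3 show ?thesis unfolding e[OF \<open>l < n\<close>] by simp
    next
      case 4
      then show ?thesis using k l by (simp add: entry)
    qed
  qed
  also have "\<dots> = complex_of_real (\<Sum>k\<le>n. d k * Bernstein n k ?x)
      + complex_of_real (sin \<alpha> / 2) * (?z * cis \<beta>)
      + complex_of_real (sin \<alpha> / 2) * (cnj ?z * cis (- \<beta>))"
    unfolding sum_tridiagonal weight of_real_sum ..
  also have "(\<Sum>k\<le>n. d k * Bernstein n k ?x) = u\<^sub>0 + u * cos \<alpha>"
  proof -
    have "d k * Bernstein n k ?x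
        = (u\<^sub>0 - u) * Bernstein n k ?x + (2 * u / real n) * (real k * Bernstein n k ?x)" for k
      using n by (simp add: d_def field_simps)
    then have "(\<Sum>k\<le>n. d k * Bernstein n k ?x)
        = (u\<^sub>0 - u) * (\<Sum>k\<le>n. Bernstein n k ?x)
          + (2 * u / real n) * (\<Sum>k\<le>n. real k * Bernstein n k ?x)"
      by (simp only: sum.distrib sum_distrib_left)
    also have "\<dots> = u\<^sub>0 + u * (2 * ?x - 1)"
      using n by (simp add: field_simps)
    also have "2 * ?x - 1 = cos \<alpha>" using cos_double_cos[of "\<alpha> / 2"] by simp
    finally show ?thesis .
  qed
  also have "complex_of_real (u\<^sub>0 + u * cos \<alpha>)
      + complex_of_real (sin \<alpha> / 2) * (?z * cis \<beta>)
      + complex_of_real (sin \<alpha> / 2) * (cnj ?z * cis (- \<beta>))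
    = complex_of_real (u\<^sub>0 + u * cos \<alpha> + v * sin \<alpha> * cos \<beta> + w * sin \<alpha> * sin \<beta>)"
    by (simp add: complex_eq_iff field_simps)
  finally show ?thesis .
qed

theorem lemma9p8:
  fixes n :: nat and u\<^sub>0 u v w :: real and f :: "real \<times> real \<times> real \<Rightarrow> real"
  assumes n: "n \<ge> 1"
    and f: "\<And>x y z. x\<^sup>2 + y\<^sup>2 + z\<^sup>2 = 1 \<Longrightarrow> f (x, y, z) = u\<^sub>0 + u * x + v * y + w * z"
  shows "(\<exists>!Q. Q \<in> Herm (n + 1) \<and>
            (\<forall>\<alpha>\<in>{0..pi}. \<forall>\<beta>\<in>{0..2 * pi}.
               complex_of_real (u\<^sub>0 + u * cos \<alpha> + v * sin \<alpha> * cos \<beta> + w * sin \<alpha> * sin \<beta>)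
                 = hprod (Psi n \<alpha> \<beta>) (Q *\<^sub>v Psi n \<alpha> \<beta>)))
       \<and> Qmat n f \<in> Herm (n + 1)
       \<and> (\<forall>\<alpha>\<in>{0..pi}. \<forall>\<beta>\<in>{0..2 * pi}.
            complex_of_real (u\<^sub>0 + u * cos \<alpha> + v * sin \<alpha> * cos \<beta> + w * sin \<alpha> * sin \<beta>)
              = hprod (Psi n \<alpha> \<beta>) (Qmat n f *\<^sub>v Psi n \<alpha> \<beta>))
       \<and> (\<forall>k\<le>n. Qmat n f $$ (k, k)
            = complex_of_real (u\<^sub>0 - u * (2 / real n) * (real n / 2 - real k)))
       \<and> (\<forall>l<n. Qmat n f $$ (l, l + 1)
            = complex_of_real (1 / real n * sqrt ((real n - real l) * (1 + real l)))
              * (complex_of_real v - \<i> * complex_of_real w))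
       \<and> (\<forall>a b. a + 2 \<le> b \<and> b \<le> n \<longrightarrow> Qmat n f $$ (a, b) = 0)"
proof -
  let ?P = "\<lambda>Q. Q \<in> Herm (n + 1) \<and>
    (\<forall>\<alpha>\<in>{0..pi}. \<forall>\<beta>\<in>{0..2 * pi}.
       complex_of_real (u\<^sub>0 + u * cos \<alpha> + v * sin \<alpha> * cos \<beta> + w * sin \<alpha> * sin \<beta>)
         = hprod (Psi n \<alpha> \<beta>) (Q *\<^sub>v Psi n \<alpha> \<beta>))"
  let ?Q = "linear_symbol_mat n u\<^sub>0 u (Complex v (- w))"
  have P: "?P ?Q"
    unfolding expectation_linear_symbol_mat[OF n] using linear_symbol_mat_Herm by blast
  have unique: "Q = ?Q" if "?P Q" for Q
  proof (rule expectation_determines_matrix)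
    show "Q \<in> carrier_mat (n + 1) (n + 1)" "?Q \<in> carrier_mat (n + 1) (n + 1)"
      using that P by (auto simp: Herm_def)
  next
    fix \<alpha> \<beta> :: real assume "\<alpha> \<in> {0..pi}" "\<beta> \<in> {0..2 * pi}"
    from conjunct2[OF that, rule_format, OF this]
    show "hprod (Psi n \<alpha> \<beta>) (Q *\<^sub>v Psi n \<alpha> \<beta>) = hprod (Psi n \<alpha> \<beta>) (?Q *\<^sub>v Psi n \<alpha> \<beta>)"
      unfolding expectation_linear_symbol_mat[OF n] by (rule sym)
  qed
  have sphere: "f (cos \<alpha>, sin \<alpha> * cos \<beta>, sin \<alpha> * sin \<beta>)
      = u\<^sub>0 + u * cos \<alpha> + v * sin \<alpha> * cos \<beta> + w * sin \<alpha> * sin \<beta>" for \<alpha> \<beta>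
  proof -
    have "(cos \<alpha>)\<^sup>2 + (sin \<alpha> * cos \<beta>)\<^sup>2 + (sin \<alpha> * sin \<beta>)\<^sup>2
        = (cos \<alpha>)\<^sup>2 + (sin \<alpha>)\<^sup>2 * ((cos \<beta>)\<^sup>2 + (sin \<beta>)\<^sup>2)"
      by (simp only: power_mult_distrib distrib_left add.assoc)
    then have "(cos \<alpha>)\<^sup>2 + (sin \<alpha> * cos \<beta>)\<^sup>2 + (sin \<alpha> * sin \<beta>)\<^sup>2 = 1" by simp
    from f[OF this] show ?thesis by (simp add: mult.assoc)
  qed
  have Qmat: "Qmat n f = ?Q"
    unfolding Qmat_def sphere using P unique by (rule the_equality)
  have z: "Complex v (- w) = complex_of_real v - \<i> * complex_of_real w"
    by (simp add: complex_eq_iff)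
  have "\<exists>!Q. ?P Q" using P unique by (rule ex1I)
  then show ?thesis
    unfolding Qmat using P by (auto simp: linear_symbol_mat_def z)
qed

end
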